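(* Let $R$ be an associative ring with unit element $1\neq 0$. The relations "radically parallel" ($\parallel$) and "non-distant" (the negation of $\triangle$) on $\mathbb{P}(R)$ coincide if, and only if, $R$ is a local ring.
   Context: All rings are associative (not necessarily commutative) with unit element $1\neq 0$. A ring $R$ is local if it has a unique maximal left ideal; equivalently, the set $R\setminus R^*$ of non-units is a two-sided ideal. $\mathrm{GL}_2(R)$ is the group of invertible $2\times 2$-matrices over $R$, acting from the right on row vectors in the free left $R$-module $R^2$. A pair $(a,b)\in R^2$ is admissible if it is the first row of some matrix in $\mathrm{GL}_2(R)$. The projective line over $R$ is $\mathbb{P}(R):=\{R(a,b)\mid (a,b)\in R^2 \text{ admissible}\}$, i.e. the orbit of the cyclic submodule $R(1,0)$ of $R^2$ under $\mathrm{GL}_2(R)$; points are always represented by admissible pairs. Two points $p=R(a,b)$, $q=R(c,d)$ (with $(a,b),(c,d)$ admissible) are called distant, written $p\mathrel{\triangle} q$, if $\begin{pmatrix}a&b\\c&d\end{pmatrix}\in\mathrm{GL}_2(R)$; equivalently, $\triangle$ is the orbit of the pair $(R(1,0),R(0,1))$ under $\mathrm{GL}_2(R)$. A point $p\in\mathbb{P}(R)$ is called radically parallel to a point $q\in\mathbb{P}(R)$, written $p\parallel q$, if for all $x\in\mathbb{P}(R)$: $x\mathrel{\triangle} p$ implies $x\mathrel{\triangle} q$. *)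

theory Defs
  imports "HOL-Analysis.Analysis"
begin

text \<open>
  \<open>R\<close> is the carrier of a type of class \<^class>\<open>ring_1\<close> (associative, \<open>1 \<noteq> 0\<close>, not necessarily
  commutative).  \<open>GL\<^sub>2(R)\<close> is the set of matrices \<open>A :: 'a^2^2\<close> with \<open>invertible A\<close>, which
  asks for a two-sided inverse.  Row vectors are elements of \<open>'a^2\<close>, and the operation \<open>*s\<close> is
  multiplication of all coordinates by a scalar from the left.
\<close>

definition left_ideal :: "'a::ring_1 set \<Rightarrow> bool"
  where "left_ideal I \<longleftrightarrow>
    0 \<in> I \<and> (\<forall>x\<in>I. \<forall>y\<in>I. x + y \<in> I) \<and> (\<forall>r. \<forall>x\<in>I. r * x \<in> I)"

definition maximal_left_ideal :: "'a::ring_1 set \<Rightarrow> bool"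
  where "maximal_left_ideal I \<longleftrightarrow>
    left_ideal I \<and> I \<noteq> UNIV \<and> (\<forall>J. left_ideal J \<and> I \<subseteq> J \<longrightarrow> J = I \<or> J = UNIV)"

definition local_ring :: "'a::ring_1 itself \<Rightarrow> bool"
  where "local_ring _ \<longleftrightarrow> (\<exists>!I :: 'a set. maximal_left_ideal I)"

definition admissible :: "'a::ring_1^2 \<Rightarrow> bool"
  where "admissible v \<longleftrightarrow> (\<exists>A :: 'a^2^2. invertible A \<and> row 1 A = v)"

definition cyclic_submodule :: "'a::ring_1^2 \<Rightarrow> ('a^2) set"
  where "cyclic_submodule v = range (\<lambda>r. r *s v)"

definition projective_line :: "('a::ring_1^2) set set"
  where "projective_line = {cyclic_submodule v | v. admissible v}"

text \<open>Here \<open>vector [v, w]\<close> is the matrix with rows \<open>v\<close> and \<open>w\<close>.  The relation does not depend on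
  the admissible representatives; see \<open>distant_cyclic_submodule_iff\<close> below.\<close>

definition distant :: "('a::ring_1^2) set \<Rightarrow> ('a^2) set \<Rightarrow> bool"
  where "distant p q \<longleftrightarrow>
    (\<exists>v w. admissible v \<and> admissible w \<and> p = cyclic_submodule v \<and> q = cyclic_submodule w \<and>
      invertible (vector [v, w] :: 'a^2^2))"

definition radically_parallel :: "('a::ring_1^2) set \<Rightarrow> ('a^2) set \<Rightarrow> bool"
  where "radically_parallel p q \<longleftrightarrow> (\<forall>x\<in>projective_line. distant x p \<longrightarrow> distant x q)"

lemma cyclic_submodule_eqD:
  fixes v v' :: "'a::ring_1^2"
  assumes "admissible v" "admissible v'" "cyclic_submodule v = cyclic_submodule v'"
  obtains r s where "v' = r *s v" "r * s = 1" "s * r = 1"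
proof -
  have cancel: "c = 1" if adm: "admissible u" and u: "u = c *s u" for u :: "'a^2" and c
  proof -
    obtain A B :: "'a^2^2" where AB: "A ** B = mat 1" "A $ 1 = u"
      using adm by (auto simp: admissible_def invertible_def row_def)
    have "(\<Sum>k\<in>UNIV. u $ k * B $ k $ 1) = 1"
      using arg_cong[OF AB(1), of "\<lambda>M. M $ 1 $ 1"] AB(2)
      by (simp add: matrix_matrix_mult_def mat_def)
    moreover have "(\<Sum>k\<in>UNIV. u $ k * B $ k $ 1) = c * (\<Sum>k\<in>UNIV. u $ k * B $ k $ 1)"
      by (subst u) (simp add: sum_distrib_left mult.assoc)
    ultimately show "c = 1" by simp
  qed
  have "v = 1 *s v" "v' = 1 *s v'" by (simp_all add: vec_eq_iff)
  then have "v \<in> cyclic_submodule v" "v' \<in> cyclic_submodule v'"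
    unfolding cyclic_submodule_def by blast+
  then have "v \<in> cyclic_submodule v'" "v' \<in> cyclic_submodule v"
    by (simp_all add: assms(3))
  then obtain r s where rs: "v' = r *s v" "v = s *s v'"
    by (auto simp: cyclic_submodule_def)
  then have "v = (s * r) *s v" "v' = (r * s) *s v'"
    by (simp_all add: vec_eq_iff mult.assoc)
  with cancel assms rs that show ?thesis by blast
qed

lemma invertible_vector_smult:
  fixes v w :: "'a::ring_1^2"
  assumes inv: "invertible (vector [v, w] :: 'a^2^2)"
    and "r * s = 1" "s * r = 1" "t * u = 1" "u * t = 1"
  shows "invertible (vector [r *s v, t *s w] :: 'a^2^2)"
proof -
  let ?D = "vector [vector [r, 0], vector [0, t]] :: 'a^2^2"
  let ?E = "vector [vector [s, 0], vector [0, u]] :: 'a^2^2"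
  have DE: "?D ** ?E = mat 1" "?E ** ?D = mat 1"
    using assms by (auto simp: vec_eq_iff matrix_matrix_mult_def mat_def forall_2 sum_2)
  obtain M where M: "(vector [v, w] :: 'a^2^2) ** M = mat 1" "M ** vector [v, w] = mat 1"
    using inv unfolding invertible_def by blast
  have eq: "vector [r *s v, t *s w] = ?D ** vector [v, w]"
    by (simp add: vec_eq_iff matrix_matrix_mult_def forall_2 sum_2)
  have "(?D ** vector [v, w]) ** (M ** ?E) = mat 1"
    by (metis DE(1) M(1) matrix_mul_assoc matrix_mul_rid)
  moreover have "(M ** ?E) ** (?D ** vector [v, w]) = mat 1"
    by (metis DE(2) M(2) matrix_mul_assoc matrix_mul_rid)
  ultimately show ?thesis unfolding eq invertible_def by blast
qed

lemma distant_cyclic_submodule_iff: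
  fixes v w :: "'a::ring_1^2"
  assumes "admissible v" "admissible w"
  shows "distant (cyclic_submodule v) (cyclic_submodule w) \<longleftrightarrow>
    invertible (vector [v, w] :: 'a^2^2)"
proof
  assume "distant (cyclic_submodule v) (cyclic_submodule w)"
  then obtain v' w' where vw: "admissible v'" "admissible w'"
    "cyclic_submodule v' = cyclic_submodule v" "cyclic_submodule w' = cyclic_submodule w"
    "invertible (vector [v', w'] :: 'a^2^2)"
    unfolding distant_def by metis
  obtain r s where "v = r *s v'" "r * s = 1" "s * r = 1"
    using cyclic_submodule_eqD[OF vw(1) assms(1) vw(3)] .
  moreover obtain t u where "w = t *s w'" "t * u = 1" "u * t = 1"
    using cyclic_submodule_eqD[OF vw(2) assms(2) vw(4)] .
  ultimately show "invertible (vector [v, w] :: 'a^2^2)"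
    using invertible_vector_smult[OF vw(5)] by blast
next
  assume "invertible (vector [v, w] :: 'a^2^2)"
  with assms show "distant (cyclic_submodule v) (cyclic_submodule w)"
    unfolding distant_def by blast
qed

end

theory Submission
  imports Defs
begin

text \<open>
  Radically parallel points are non-distant over every ring, since a point is never distant from
  itself.  If \<open>R\<close> is local and \<open>x \<triangle> p\<close>, then \<open>GL\<^sub>2(R)\<close> takes \<open>x, p\<close> to \<open>R(1,0), R(0,1)\<close> and \<open>q\<close> to
  some \<open>R(c,d)\<close>, where one of \<open>c, d\<close> is a unit; if \<open>p, q\<close> are non-distant then \<open>c\<close> is not, so \<open>d\<close> is,
  and \<open>x \<triangle> q\<close>.  Conversely, for a non-unit \<open>a\<close> the points \<open>R(1,0)\<close> and \<open>R(1,a)\<close> are non-distant, so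
  they are radically parallel, and the points \<open>R(b,1)\<close> show that \<open>1 - b a\<close> is a unit for all \<open>b\<close>.
  Thus every non-unit lies in the Jacobson radical.
\<close>

section \<open>Units, left ideals and local rings\<close>

definition ring_unit :: "'a::ring_1 \<Rightarrow> bool"
  where "ring_unit a \<longleftrightarrow> (\<exists>b. a * b = 1 \<and> b * a = 1)"

lemma ring_unitI: "a * b = 1 \<Longrightarrow> b * a = 1 \<Longrightarrow> ring_unit a"
  by (auto simp: ring_unit_def)

lemma ring_unit_1: "ring_unit 1"
  by (rule ring_unitI[of _ 1]) auto

lemma not_ring_unit_0: "\<not> ring_unit 0"
  by (auto simp: ring_unit_def)

lemma ring_unit_mult:
  assumes "ring_unit a" "ring_unit b"
  shows "ring_unit (a * b)"
proof -
  obtain a' b' where "a * a' = 1" "a' * a = 1" "b * b' = 1" "b' * b = 1"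
    using assms by (auto simp: ring_unit_def)
  then have "(a * b) * (b' * a') = 1" "(b' * a') * (a * b) = 1"
    by (metis mult.assoc mult.right_neutral)+
  then show ?thesis by (rule ring_unitI)
qed

lemma left_ideal_eq_UNIV:
  assumes "left_ideal I" "x \<in> I" "y * x = 1"
  shows "I = UNIV"
proof -
  have "1 \<in> I" using assms by (metis left_ideal_def)
  then have "r * 1 \<in> I" for r using assms(1) unfolding left_ideal_def by blast
  then show ?thesis by auto
qed

text \<open>Members of a chain are comparable, so two summands always lie in a common
  member.\<close>

lemma left_ideal_Union_chain:
  assumes "C \<noteq> {}" "subset.chain {I. left_ideal I} C"
  shows "left_ideal (\<Union>C)"
proof -
  have ideal: "left_ideal I" if "I \<in> C" for I
    using assms(2) that by (auto simp: subset_chain_def)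
  have "x + y \<in> \<Union>C" if xy: "x \<in> \<Union>C" "y \<in> \<Union>C" for x y
  proof -
    obtain I J where "I \<in> C" "J \<in> C" "x \<in> I" "y \<in> J" using xy by auto
    moreover have "I \<subseteq> J \<or> J \<subseteq> I"
      using assms(2) \<open>I \<in> C\<close> \<open>J \<in> C\<close> by (auto simp: subset_chain_def)
    ultimately obtain K where "K \<in> C" "x \<in> K" "y \<in> K" by auto
    then show ?thesis using ideal[of K] by (auto simp: left_ideal_def)
  qed
  moreover have "0 \<in> \<Union>C"
    using assms(1) ideal by (auto simp: left_ideal_def)
  moreover have "r * x \<in> \<Union>C" if "x \<in> \<Union>C" for r x
    using that ideal unfolding left_ideal_def by blast
  ultimately show ?thesis by (auto simp: left_ideal_def)
qed

text \<open>Zorn's lemma for the left ideals avoiding 1. For a left ideal this means being proper,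
  and in this form the condition visibly passes to unions of chains.\<close>

lemma maximal_left_ideal_extends:
  assumes "left_ideal I" "1 \<notin> I"
  obtains M where "maximal_left_ideal M" "I \<subseteq> M"
proof -
  let ?A = "{J. left_ideal J \<and> I \<subseteq> J \<and> 1 \<notin> J}"
  have "\<exists>M\<in>?A. \<forall>J\<in>?A. M \<subseteq> J \<longrightarrow> J = M"
  proof (rule subset_Zorn_nonempty)
    show "?A \<noteq> {}" using assms by blast
  next
    fix C assume C: "C \<noteq> {}" "subset.chain ?A C"
    then have "subset.chain {J. left_ideal J} C" by (auto simp: subset_chain_def)
    then have "left_ideal (\<Union>C)" using C(1) by (rule left_ideal_Union_chain[rotated])
    moreover have "I \<subseteq> \<Union>C" "1 \<notin> \<Union>C" using C unfolding subset_chain_def by blast+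
    ultimately show "\<Union>C \<in> ?A" by blast
  qed
  then obtain M where M: "left_ideal M" "I \<subseteq> M" "1 \<notin> M"
    and max: "\<And>J. left_ideal J \<Longrightarrow> I \<subseteq> J \<Longrightarrow> 1 \<notin> J \<Longrightarrow> M \<subseteq> J \<Longrightarrow> J = M"
    by auto
  have "J = M \<or> J = UNIV" if "left_ideal J" "M \<subseteq> J" for J
    using max[of J] that M(2) left_ideal_eq_UNIV[of J 1 1] by auto
  with M that[of M] show ?thesis by (auto simp: maximal_left_ideal_def)
qed

lemma left_ideal_principal: "left_ideal (range (\<lambda>r. r * a))"
proof -
  have "0 \<in> range (\<lambda>r. r * a)" by (rule range_eqI[of _ _ 0]) simp
  then show ?thesis
    unfolding left_ideal_def
    by (auto simp flip: distrib_right mult.assoc)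
qed

text \<open>If \<open>a\<close> had no left inverse, the principal left ideal of \<open>a\<close>
  would extend to a maximal left ideal, hence lie in \<open>M\<close>. So every element outside
  \<open>M\<close> has a left inverse \<open>b\<close>; as \<open>b\<close> is outside
  \<open>M\<close> too, it has a left inverse, which must be \<open>a\<close>.\<close>

lemma local_ring_non_units:
  assumes "local_ring TYPE('a::ring_1)"
  obtains M :: "'a::ring_1 set" where "left_ideal M" "\<And>a. a \<in> M \<longleftrightarrow> \<not> ring_unit a"
proof -
  obtain M :: "'a set" where M: "maximal_left_ideal M"
    and uniq: "\<And>N. maximal_left_ideal N \<Longrightarrow> N = M"
    using assms by (auto simp: local_ring_def)
  have ideal: "left_ideal M" and proper: "M \<noteq> UNIV"
    using M by (auto simp: maximal_left_ideal_def)
  have not_in: "a \<notin> M" if "b * a = 1" for a b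
    using left_ideal_eq_UNIV[OF ideal _ that] proper by blast
  have left_inv: "\<exists>b. b * a = 1" if "a \<notin> M" for a
  proof (rule ccontr)
    assume "\<nexists>b. b * a = 1"
    then have "1 \<notin> range (\<lambda>r. r * a)" by (metis rangeE)
    then obtain N where "maximal_left_ideal N" "range (\<lambda>r. r * a) \<subseteq> N"
      using maximal_left_ideal_extends[OF left_ideal_principal] by blast
    moreover have "a \<in> range (\<lambda>r. r * a)" by (rule range_eqI[of _ _ 1]) simp
    ultimately show False using uniq that by blast
  qed
  have unit: "ring_unit a" if "a \<notin> M" for a
  proof -
    obtain b where b: "b * a = 1" using left_inv \<open>a \<notin> M\<close> by blast
    \<comment> \<open>As \<open>M\<close> is proper, \<open>a * b\<close> and
      \<open>1 - a * b\<close> cannot both lie in it. A left inverse of \<open>1 - a * b\<close>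
      then cancels in \<open>(1 - a * b) * a = 0\<close>.\<close>
    have "b \<notin> M"
    proof
      assume "b \<in> M"
      then have "a * b \<in> M" using ideal by (auto simp: left_ideal_def)
      have "1 - a * b \<notin> M"
      proof
        assume "1 - a * b \<in> M"
        then have "(1 - a * b) + a * b \<in> M"
          using \<open>a * b \<in> M\<close> ideal unfolding left_ideal_def by blast
        then show False using not_in[of 1 1] by simp
      qed
      then obtain c where c: "c * (1 - a * b) = 1" using left_inv by blast
      have "(1 - a * b) * a = 0" by (simp add: left_diff_distrib mult.assoc b)
      then have "a = 0" by (metis c mult.assoc mult_1 mult_zero_right)
      then show False using b by simp
    qed
    then obtain c where "c * b = 1" using left_inv by blast
    then have "c = a" by (metis b mult.assoc mult_1 mult.right_neutral)
    then show ?thesis using b \<open>c * b = 1\<close> by (auto intro: ring_unitI)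
  qed
  have "a \<in> M \<longleftrightarrow> \<not> ring_unit a" for a
    using unit not_in by (auto simp: ring_unit_def)
  with ideal that show ?thesis by blast
qed

text \<open>The non-units form a left ideal without 1, so one of the two summands is a unit, and a
  left factor of a unit is a unit here.\<close>

lemma local_ring_unimodular:
  fixes a b :: "'a::ring_1"
  assumes "local_ring TYPE('a)" "a * x + b * y = 1"
  shows "ring_unit a \<or> ring_unit b"
proof -
  obtain M :: "'a set" where ideal: "left_ideal M" and M: "\<And>a. a \<in> M \<longleftrightarrow> \<not> ring_unit a"
    using local_ring_non_units[OF assms(1)] by blast
  have left: "ring_unit c" if "d * c = 1" for c d :: 'a
    using left_ideal_eq_UNIV[OF ideal _ that] M ring_unit_1 by blast
  have factor: "ring_unit c" if cd: "ring_unit (c * d)" for c d :: 'a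
  proof -
    obtain e where "c * d * e = 1" using cd by (auto simp: ring_unit_def)
    \<comment> \<open>Now \<open>c\<close> is a left inverse of \<open>d * e\<close>, so
      \<open>d * e\<close> is a unit by \<open>left\<close>, and its inverse \<open>f\<close> must
      be \<open>c\<close>.\<close>
    then have ce: "c * (d * e) = 1" by (simp add: mult.assoc)
    then obtain f where f: "d * e * f = 1" "f * (d * e) = 1"
      using left[OF ce] by (auto simp: ring_unit_def)
    then have "f = c" by (metis ce mult.assoc mult_1 mult.right_neutral)
    then show ?thesis using f by (auto intro: ring_unitI)
  qed
  have "a * x \<notin> M \<or> b * y \<notin> M"
    using assms(2) ideal M ring_unit_1 unfolding left_ideal_def by metis
  then show ?thesis using M factor by blast
qed

text \<open>The hypothesis puts all non-units into the Jacobson radical. They then form a left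
  ideal; every proper left ideal consists of non-units, so this one is the largest and the only
  maximal one.\<close>

lemma local_ringI:
  assumes "\<And>a b :: 'a::ring_1. \<not> ring_unit a \<Longrightarrow> ring_unit (1 - b * a)"
  shows "local_ring TYPE('a)"
proof -
  let ?N = "{a :: 'a. \<not> ring_unit a}"
  have N: "a \<in> ?N \<longleftrightarrow> (\<forall>b. ring_unit (1 - b * a))" for a
  proof -
    \<comment> \<open>The inverse of a unit \<open>a\<close>, taken as \<open>b\<close>, makes
      \<open>1 - b * a\<close> the non-unit 0.\<close>
    have "\<exists>b. 1 - b * a = 0" if "ring_unit a"
      using that by (auto simp: ring_unit_def)
    then show ?thesis using assms not_ring_unit_0 by (metis mem_Collect_eq)
  qed
  have add: "x + y \<in> ?N" if x: "x \<in> ?N" and y: "y \<in> ?N" for x y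
    unfolding N
  proof
    fix b
    obtain u where u: "(1 - b * x) * u = 1" "u * (1 - b * x) = 1"
      using x assms[of x b] unfolding ring_unit_def by blast
    \<comment> \<open>The unit \<open>1 - b * x\<close> with inverse \<open>u\<close> is split off
      on the left. The other factor is a unit because \<open>y\<close> is in \<open>?N\<close>, used
      with the multiplier \<open>u * b\<close>.\<close>
    have "1 - b * (x + y) = (1 - b * x) - (1 - b * x) * u * (b * y)"
      by (simp add: u(1) distrib_left)
    also have "\<dots> = (1 - b * x) * (1 - u * b * y)"
      by (simp only: right_diff_distrib mult.right_neutral mult.assoc)
    finally have eq: "1 - b * (x + y) = (1 - b * x) * (1 - u * b * y)" .
    show "ring_unit (1 - b * (x + y))"
      unfolding eq using x y N by (intro ring_unit_mult) blast+
  qed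
  have smult: "r * x \<in> ?N" if "x \<in> ?N" for r x
    using that unfolding N by (simp flip: mult.assoc)
  have "left_ideal ?N"
    using add smult not_ring_unit_0 unfolding left_ideal_def by blast
  moreover have "?N \<noteq> UNIV" using ring_unit_1 by blast
  moreover have sub: "I \<subseteq> ?N" if "left_ideal I" "I \<noteq> UNIV" for I
    using left_ideal_eq_UNIV[OF that(1)] that(2) by (auto simp: ring_unit_def)
  ultimately have "maximal_left_ideal ?N"
    unfolding maximal_left_ideal_def by blast
  moreover have "I = ?N" if "maximal_left_ideal I" for I
    using that sub[of I] \<open>left_ideal ?N\<close> \<open>?N \<noteq> UNIV\<close> unfolding maximal_left_ideal_def by blast
  ultimately show ?thesis unfolding local_ring_def by blast
qed

section \<open>Invertible 2 x 2 matrices\<close>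

abbreviation mat2 :: "'a::ring_1 \<Rightarrow> 'a \<Rightarrow> 'a \<Rightarrow> 'a \<Rightarrow> 'a^2^2"
  where "mat2 a b c d \<equiv> vector [vector [a, b], vector [c, d]]"

lemma mat2_mult:
  "mat2 a b c d ** mat2 p q r s =
    mat2 (a * p + b * r) (a * q + b * s) (c * p + d * r) (c * q + d * s)"
  by (simp add: vec_eq_iff matrix_matrix_mult_def forall_2 sum_2)

lemma mat2_eq_mat_1: "mat2 a b c d = mat 1 \<longleftrightarrow> a = 1 \<and> b = 0 \<and> c = 0 \<and> d = 1"
  by (auto simp: vec_eq_iff mat_def forall_2)

lemma mat2_cases:
  fixes A :: "'a::ring_1^2^2"
  obtains a b c d where "A = mat2 a b c d"
proof
  show "A = mat2 (A $ 1 $ 1) (A $ 1 $ 2) (A $ 2 $ 1) (A $ 2 $ 2)"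
    by (simp add: vec_eq_iff forall_2)
qed

text \<open>Over a noncommutative ring there is no determinant criterion, so both products with the
  inverse are spelled out entrywise.\<close>

lemma invertible_mat2_iff:
  "invertible (mat2 a b c d) \<longleftrightarrow>
    (\<exists>p q r s. a * p + b * r = 1 \<and> a * q + b * s = 0 \<and> c * p + d * r = 0 \<and> c * q + d * s = 1 \<and>
      p * a + q * c = 1 \<and> p * b + q * d = 0 \<and> r * a + s * c = 0 \<and> r * b + s * d = 1)"
proof -
  have "invertible (mat2 a b c d) \<longleftrightarrow> (\<exists>p q r s.
      mat2 a b c d ** mat2 p q r s = mat 1 \<and> mat2 p q r s ** mat2 a b c d = mat 1)"
    unfolding invertible_def by (metis mat2_cases)
  then show ?thesis by (simp add: mat2_mult mat2_eq_mat_1 conj_assoc)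
qed

text \<open>Meant for \<open>c\<close>, \<open>d\<close> as coordinates of a point relative to two
  distant points: a unit coordinate makes it distant from one of them. The witnesses are the entries
  of the inverse matrix.\<close>

lemma invertible_mat2_1_0_left:
  assumes "ring_unit d"
  shows "invertible (mat2 1 0 c d)"
proof -
  obtain e where "d * e = 1" "e * d = 1" using assms by (auto simp: ring_unit_def)
  then show ?thesis unfolding invertible_mat2_iff
    by (intro exI[of _ 1] exI[of _ 0] exI[of _ "- (e * c)"] exI[of _ e])
      (simp flip: mult.assoc)
qed

lemma invertible_mat2_0_1_left:
  assumes "ring_unit c"
  shows "invertible (mat2 0 1 c d)"
proof -
  obtain e where "c * e = 1" "e * c = 1" using assms by (auto simp: ring_unit_def)
  then show ?thesis unfolding invertible_mat2_iff
    by (intro exI[of _ "- (e * d)"] exI[of _ e] exI[of _ 1] exI[of _ 0])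
      (simp flip: mult.assoc)
qed

lemma invertible_mat2_1_0_leftD:
  assumes "invertible (mat2 1 0 c d)"
  shows "ring_unit d"
proof -
  obtain p q r s where "1 * q + 0 * s = 0" "c * q + d * s = 1" "r * 0 + s * d = 1"
    using assms unfolding invertible_mat2_iff by blast
  then show ?thesis by (intro ring_unitI[of _ s]) simp_all
qed

text \<open>Eliminating the diagonal entries \<open>p\<close> and \<open>s\<close> of the inverse
  matrix shows that its lower left entry \<open>r\<close> inverts \<open>1 - b * a\<close> on both
  sides.\<close>

lemma invertible_mat2_anti_1D:
  assumes "invertible (mat2 b 1 1 a)"
  shows "ring_unit (1 - b * a)"
proof -
  obtain p q r s where eqs: "b * p + 1 * r = 1" "1 * p + a * r = 0"
    "r * b + s * 1 = 0" "r * 1 + s * a = 1"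
    using assms unfolding invertible_mat2_iff by blast
  have "p = - (a * r)" "s = - (r * b)"
    using eqs(2,3) by (simp_all add: eq_neg_iff_add_eq_0 add.commute)
  then show ?thesis using eqs(1,4)
    by (intro ring_unitI[of _ r]) (simp_all add: algebra_simps)
qed

lemma invertible_vector_commute:
  fixes v w :: "'a::ring_1^2"
  assumes "invertible (vector [v, w] :: 'a^2^2)"
  shows "invertible (vector [w, v] :: 'a^2^2)"
proof -
  have "vector [w, v] = mat2 0 1 1 0 ** (vector [v, w] :: 'a^2^2)"
    by (simp add: vec_eq_iff matrix_matrix_mult_def forall_2 sum_2)
  then show ?thesis
    using invertible_mult[OF invertible_mat2_0_1_left[OF ring_unit_1] assms] by simp
qed

lemma not_invertible_vector_same:
  fixes v :: "'a::ring_1^2"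
  shows "\<not> invertible (vector [v, v] :: 'a^2^2)"
proof
  assume "invertible (vector [v, v] :: 'a^2^2)"
  then obtain B :: "'a^2^2" where B: "vector [v, v] ** B = mat 1"
    unfolding invertible_def by blast
  have "((vector [v, v] :: 'a^2^2) ** B) $ 1 $ 1 = ((vector [v, v] :: 'a^2^2) ** B) $ 2 $ 1"
    by (simp add: matrix_matrix_mult_def)
  then show False unfolding B by (simp add: mat_def)
qed

lemma admissible_vector:
  assumes "invertible (vector [v, w] :: 'a::ring_1^2^2)"
  shows "admissible v" "admissible w"
proof -
  have "row 1 (vector [v, w] :: 'a^2^2) = v" "row 1 (vector [w, v] :: 'a^2^2) = w"
    by (simp_all add: row_def vec_eq_iff)
  then show "admissible v" "admissible w"
    using assms invertible_vector_commute[OF assms] unfolding admissible_def by blast+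
qed

section \<open>Radical parallelism and distance on the projective line\<close>

lemma radically_parallel_not_distant:
  assumes "p \<in> projective_line" "q \<in> projective_line" "radically_parallel p q"
  shows "\<not> distant p q"
proof
  assume "distant p q"
  obtain v w where v: "admissible v" "p = cyclic_submodule v"
    and w: "admissible w" "q = cyclic_submodule w"
    using assms(1,2) by (auto simp: projective_line_def)
  \<comment> \<open>By symmetry, \<open>q\<close> itself can serve as the test point for
    \<open>p\<close> and \<open>q\<close>.\<close>
  have "distant q p"
    using \<open>distant p q\<close> v w by (simp add: distant_cyclic_submodule_iff invertible_vector_commute)
  then have "distant q q" using assms unfolding radically_parallel_def by blast
  then show False using w by (simp add: distant_cyclic_submodule_iff not_invertible_vector_same)
qed

lemma local_ring_not_distant_radically_parallel:
  fixes p q :: "('a::ring_1^2) set"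
  assumes "local_ring TYPE('a)" "p \<in> projective_line" "q \<in> projective_line" "\<not> distant p q"
  shows "radically_parallel p q"
  unfolding radically_parallel_def
proof (intro ballI impI)
  fix x :: "('a^2) set"
  assume "x \<in> projective_line" "distant x p"
  then obtain v where v: "admissible v" "x = cyclic_submodule v"
    by (auto simp: projective_line_def)
  obtain w u where w: "admissible w" "p = cyclic_submodule w"
    and u: "admissible u" "q = cyclic_submodule u"
    using assms(2,3) by (auto simp: projective_line_def)
  let ?A = "vector [v, w] :: 'a^2^2"
  have A: "invertible ?A"
    using \<open>distant x p\<close> v w by (simp add: distant_cyclic_submodule_iff)
  then obtain A' where A': "?A ** A' = mat 1" "A' ** ?A = mat 1"
    unfolding invertible_def by blast
  then have "invertible A'" unfolding invertible_def by blast
  obtain B :: "'a^2^2" where B: "invertible B" "row 1 B = u"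
    using u by (auto simp: admissible_def)
  \<comment> \<open>The first row of this product is \<open>u\<close> times the inverse of
    \<open>?A\<close>, so \<open>c\<close> and \<open>d\<close> are the coordinates of
    \<open>u\<close> in the basis \<open>v\<close>, \<open>w\<close>.\<close>
  obtain c d e f where C: "B ** A' = mat2 c d e f" by (rule mat2_cases)
  have "invertible (mat2 c d e f)"
    unfolding C[symmetric] using B(1) \<open>invertible A'\<close> by (rule invertible_mult)
  \<comment> \<open>The first column of the inverse matrix shows that the row \<open>c\<close>,
    \<open>d\<close> is unimodular.\<close>
  then have unit: "ring_unit c \<or> ring_unit d"
    using local_ring_unimodular[OF assms(1)] unfolding invertible_mat2_iff by blast
  have "B = mat2 c d e f ** ?A"
    by (metis A'(2) C matrix_mul_assoc matrix_mul_rid)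
  then have u_eq: "u = vector [c * v $ 1 + d * w $ 1, c * v $ 2 + d * w $ 2]"
    using B(2) by (simp add: row_def vec_eq_iff forall_2 matrix_matrix_mult_def sum_2)
  \<comment> \<open>A unit \<open>c\<close> would make \<open>p\<close> and \<open>q\<close>
    distant, so \<open>d\<close> has to be the unit.\<close>
  have "vector [w, u] = mat2 0 1 c d ** ?A"
    by (simp add: u_eq vec_eq_iff forall_2 matrix_matrix_mult_def sum_2)
  then have "invertible (vector [w, u] :: 'a^2^2)" if "ring_unit c"
    using invertible_mult[OF invertible_mat2_0_1_left[OF that] A] by simp
  then have "ring_unit d"
    using unit assms(4) w u by (auto simp: distant_cyclic_submodule_iff)
  moreover have "vector [v, u] = mat2 1 0 c d ** ?A"
    by (simp add: u_eq vec_eq_iff forall_2 matrix_matrix_mult_def sum_2)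
  ultimately have "invertible (vector [v, u] :: 'a^2^2)"
    using invertible_mult[OF invertible_mat2_1_0_left A] by simp
  then show "distant x q" using v u by (simp add: distant_cyclic_submodule_iff)
qed

lemma local_ring_if_not_distant_radically_parallel:
  assumes "\<And>p q :: ('a::ring_1^2) set. p \<in> projective_line \<Longrightarrow> q \<in> projective_line \<Longrightarrow>
    \<not> distant p q \<Longrightarrow> radically_parallel p q"
  shows "local_ring TYPE('a)"
proof (rule local_ringI)
  fix a b :: 'a
  assume a: "\<not> ring_unit a"
  let ?p = "vector [1, 0] :: 'a^2" and ?q = "vector [1, a] :: 'a^2"
    and ?x = "vector [b, 1] :: 'a^2"
  have px: "invertible (mat2 1 0 b 1)"
    by (rule invertible_mat2_1_0_left[OF ring_unit_1])
  \<comment> \<open>The row \<open>(1, a)\<close> is the second row of an invertible matrix;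
    swapping rows makes it a first row.\<close>
  have adm: "admissible ?p" "admissible ?x" "admissible ?q"
    using admissible_vector[OF px]
      admissible_vector(2)[OF invertible_mat2_0_1_left[OF ring_unit_1, of a]] by blast+
  have pts: "cyclic_submodule ?p \<in> projective_line" "cyclic_submodule ?x \<in> projective_line"
      "cyclic_submodule ?q \<in> projective_line"
    using adm unfolding projective_line_def by blast+
  have "\<not> distant (cyclic_submodule ?p) (cyclic_submodule ?q)"
    using a invertible_mat2_1_0_leftD adm by (auto simp: distant_cyclic_submodule_iff)
  then have "radically_parallel (cyclic_submodule ?p) (cyclic_submodule ?q)"
    using assms pts by blast
  \<comment> \<open>This holds for every \<open>b\<close>; carried over to \<open>?q\<close>, it
    makes \<open>mat2 b 1 1 a\<close> invertible.\<close>
  moreover have "distant (cyclic_submodule ?x) (cyclic_submodule ?p)"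
    using adm invertible_vector_commute[OF px] by (simp add: distant_cyclic_submodule_iff)
  ultimately have "distant (cyclic_submodule ?x) (cyclic_submodule ?q)"
    using pts unfolding radically_parallel_def by blast
  then show "ring_unit (1 - b * a)"
    using adm by (auto simp: distant_cyclic_submodule_iff intro: invertible_mat2_anti_1D)
qed

theorem theorem2p5:
  shows "(\<forall>p \<in> (projective_line :: ('a::ring_1^2) set set). \<forall>q \<in> projective_line.
            radically_parallel p q \<longleftrightarrow> \<not> distant p q)
         \<longleftrightarrow> local_ring TYPE('a)"
  using local_ring_if_not_distant_radically_parallel local_ring_not_distant_radically_parallel
    radically_parallel_not_distant by blast

end
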